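(* Let $F=(F_1,\dots,F_m):\mathbb{R}^n\to\mathbb{R}^m$ be a convex map such that $\lim_{\|x\|\to\infty}F_r(x)=\infty$ for some $r\in\{1,\dots,m\}$, let $f:\mathbb{R}^n\times\mathbb{R}^m_+\to\mathbb{R}$ be a function satisfying properties (P1)–(P4), and let $q:\mathbb{R}^n\times\mathbb{R}^n\to\mathbb{R}_+$ be a quasi-distance for which there are constants $a,b>0$ with $a\|x-y\|\le q(x,y)\le b\|x-y\|$ for all $x,y\in\mathbb{R}^n$. Let $\{\mu^k\}_{k\in\mathbb{N}}$ and $\{\beta^k\}_{k\in\mathbb{N}}$ be sequences of positive real numbers with $0<l<\mu^k<L$ for all $k\in\mathbb{N}$, for some constants $l,L$. Then every sequence $\{(x^k,z^k)\}_{k\in\mathbb{N}}$ generated by the LQDPS method is bounded, and each cluster point of $\{x^k\}_{k\in\mathbb{N}}$ is a weak Pareto solution of the unconstrained multi-objective problem $\min\{F(x): x\in\mathbb{R}^n\}$.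
   Context: $\mathbb{N}=\{0,1,2,\dots\}$; $\mathbb{R}^m_+$ and $\mathbb{R}^m_{++}$ are the sets of vectors in $\mathbb{R}^m$ with all components $\ge 0$, respectively $>0$; $\|\cdot\|$ is the Euclidean norm. Vector inequalities $F(x)\le F(y)$ are componentwise. $F$ is convex if every component $F_i$ is convex. $e=(1,\dots,1)\in\mathbb{R}^m$; for $z,w\in\mathbb{R}^m_{++}$, $z/w$ and $\log(z/w)$ denote the vectors with components $z_i/w_i$ and $\log(z_i/w_i)$. Quasi-distance: a map $q:\mathbb{R}^n\times\mathbb{R}^n\to\mathbb{R}_+$ with $q(x,y)=q(y,x)=0\iff x=y$ and $q(x,z)\le q(x,y)+q(y,z)$ for all $x,y,z$ (symmetry is not required). Properties of $f:\mathbb{R}^n\times\mathbb{R}^m_+\to\mathbb{R}$: (P1) $f$ is bounded below: there is $\alpha\in\mathbb{R}$ with $f(x,z)\ge\alpha$ for all $(x,z)\in\mathbb{R}^n\times\mathbb{R}^m_+$. (P2) $f$ is (jointly) convex on $\mathbb{R}^n\times\mathbb{R}^m_+$. (P3) For all $x,y\in\mathbb{R}^n$ and $z\in\mathbb{R}^m_+$: if $F_i(x)\le F_i(y)$ for all $i$ then $f(x,z)\le f(y,z)$; if $F_i(x)<F_i(y)$ for all $i$ then $f(x,z)<f(y,z)$. (P4) $f$ is differentiable with respect to $z$ and $\frac{\partial}{\partial z}f(x,z)=h(x,z)$, where $h=(h_1,\dots,h_m)$ is a continuous map on $\mathbb{R}^n\times\mathbb{R}^m_+$ with values in $\mathbb{R}^m_+$.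 LQDPS method: given $x^0\in\mathbb{R}^n$, $z^0\in\mathbb{R}^m_{++}$, a sequence $\{(x^k,z^k)\}\subset\mathbb{R}^n\times\mathbb{R}^m_{++}$ is generated by the method if for every $k\in\mathbb{N}$, $(x^{k+1},z^{k+1})$ is a solution of the LQDPS problem $$\min\ \varphi^k(x,z)=f(x,z)+\beta^k\Big\langle \tfrac{z}{z^k}-\log\tfrac{z}{z^k}-e,\ e\Big\rangle+\tfrac{\mu^k}{2}q^2(x,x^k)\quad\text{subject to } x\in\Omega^k,\ z\in\mathbb{R}^m_{++},$$ where $\Omega^k=\{x\in\mathbb{R}^n: F(x)\le F(x^k)\}$. Weak Pareto solution: a point $\bar a\in\mathbb{R}^n$ such that there is no $x\in\mathbb{R}^n$ with $F_i(x)<F_i(\bar a)$ for all $i=1,\dots,m$ (since $F$ is convex, this is equivalent to the local version of the definition). *)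

theory Defs
  imports "HOL-Analysis.Analysis"
begin

text \<open>On \<open>real ^ 'm\<close> the library order \<open>\<le>\<close> is the componentwise one, but \<open><\<close> is its strict part
  (\<open>\<le>\<close> and different), not the componentwise strict inequality; the latter is therefore always written out.
  The vector \<open>e = (1, \<dots>, 1)\<close> is \<open>1 :: real ^ 'm\<close>.\<close>

definition nonneg_orthant :: "(real ^ 'm) set" where
  "nonneg_orthant = {z. \<forall>i. 0 \<le> z $ i}"

definition pos_orthant :: "(real ^ 'm) set" where
  "pos_orthant = {z. \<forall>i. 0 < z $ i}"

definition convex_map :: "(real ^ 'n \<Rightarrow> real ^ 'm) \<Rightarrow> bool" where
  "convex_map F \<longleftrightarrow> (\<forall>i. convex_on UNIV (\<lambda>x. F x $ i))"

definition quasi_distance :: "('a \<Rightarrow> 'a \<Rightarrow> real) \<Rightarrow> bool" where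
  "quasi_distance q \<longleftrightarrow>
     (\<forall>x y. 0 \<le> q x y) \<and>
     (\<forall>x y. (q x y = 0 \<and> q y x = 0) \<longleftrightarrow> x = y) \<and>
     (\<forall>x y z. q x z \<le> q x y + q y z)"

text \<open>A function \<open>f\<close> on \<open>\<real>\<^sup>n \<times> \<real>\<^sup>m\<^sub>+\<close> is rendered as a total curried function; its values at \<open>z\<close> outside
  \<open>nonneg_orthant\<close> are never constrained or used.\<close>

definition prop_P1 :: "(real ^ 'n \<Rightarrow> real ^ 'm \<Rightarrow> real) \<Rightarrow> bool" where
  "prop_P1 f \<longleftrightarrow> (\<exists>\<alpha>. \<forall>x. \<forall>z\<in>nonneg_orthant. \<alpha> \<le> f x z)"

definition prop_P2 :: "(real ^ 'n \<Rightarrow> real ^ 'm \<Rightarrow> real) \<Rightarrow> bool" where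
  "prop_P2 f \<longleftrightarrow> convex_on (UNIV \<times> nonneg_orthant) (\<lambda>(x, z). f x z)"

definition prop_P3 :: "(real ^ 'n \<Rightarrow> real ^ 'm) \<Rightarrow> (real ^ 'n \<Rightarrow> real ^ 'm \<Rightarrow> real) \<Rightarrow> bool" where
  "prop_P3 F f \<longleftrightarrow>
     (\<forall>x y. \<forall>z\<in>nonneg_orthant.
        (F x \<le> F y \<longrightarrow> f x z \<le> f y z) \<and>
        ((\<forall>i. F x $ i < F y $ i) \<longrightarrow> f x z < f y z))"

text \<open>The gradient of \<open>f x\<close> at \<open>z\<close> is \<open>h x z\<close>. On the boundary of the orthant only increments that stay in
  the orthant make sense, hence the derivative \<open>within\<close> the orthant.\<close>

definition prop_P4 :: "(real ^ 'n \<Rightarrow> real ^ 'm \<Rightarrow> real) \<Rightarrow> bool" where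
  "prop_P4 f \<longleftrightarrow>
     (\<exists>h :: real ^ 'n \<Rightarrow> real ^ 'm \<Rightarrow> real ^ 'm.
        continuous_on (UNIV \<times> nonneg_orthant) (\<lambda>(x, z). h x z) \<and>
        (\<forall>x. \<forall>z\<in>nonneg_orthant. h x z \<in> nonneg_orthant \<and>
           (f x has_derivative (\<lambda>d. h x z \<bullet> d)) (at z within nonneg_orthant)))"

definition log_quad_term :: "real ^ 'm \<Rightarrow> real ^ 'm \<Rightarrow> real" where
  "log_quad_term z w = ((\<chi> i. z $ i / w $ i) - (\<chi> i. ln (z $ i / w $ i)) - 1) \<bullet> 1"

definition lqdps_objective ::
  "(real ^ 'n \<Rightarrow> real ^ 'm \<Rightarrow> real) \<Rightarrow> (real ^ 'n \<Rightarrow> real ^ 'n \<Rightarrow> real) \<Rightarrow> real \<Rightarrow> real \<Rightarrow>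
   real ^ 'n \<Rightarrow> real ^ 'm \<Rightarrow> (real ^ 'n) \<times> (real ^ 'm) \<Rightarrow> real" where
  "lqdps_objective f q \<beta>\<^sub>k \<mu>\<^sub>k x\<^sub>k z\<^sub>k =
     (\<lambda>(x, z). f x z + \<beta>\<^sub>k * log_quad_term z z\<^sub>k + \<mu>\<^sub>k / 2 * (q x x\<^sub>k)\<^sup>2)"

definition lqdps_sequence ::
  "(real ^ 'n \<Rightarrow> real ^ 'm) \<Rightarrow> (real ^ 'n \<Rightarrow> real ^ 'm \<Rightarrow> real) \<Rightarrow> (real ^ 'n \<Rightarrow> real ^ 'n \<Rightarrow> real) \<Rightarrow>
   (nat \<Rightarrow> real) \<Rightarrow> (nat \<Rightarrow> real) \<Rightarrow> (nat \<Rightarrow> real ^ 'n) \<Rightarrow> (nat \<Rightarrow> real ^ 'm) \<Rightarrow> bool" where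
  "lqdps_sequence F f q \<beta> \<mu> x z \<longleftrightarrow>
     z 0 \<in> pos_orthant \<and>
     (\<forall>k. is_arg_min (lqdps_objective f q (\<beta> k) (\<mu> k) (x k) (z k))
            (\<lambda>p. p \<in> {u. F u \<le> F (x k)} \<times> pos_orthant)
            (x (Suc k), z (Suc k)))"

definition weak_pareto :: "(real ^ 'n \<Rightarrow> real ^ 'm) \<Rightarrow> real ^ 'n \<Rightarrow> bool" where
  "weak_pareto F a \<longleftrightarrow> \<not> (\<exists>x. \<forall>i. F x $ i < F a $ i)"

definition seq_cluster_point :: "(nat \<Rightarrow> 'a::topological_space) \<Rightarrow> 'a \<Rightarrow> bool" where
  "seq_cluster_point u a \<longleftrightarrow> (\<exists>s. strict_mono s \<and> (u \<circ> s) \<longlonglongrightarrow> a)"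

end

theory Submission
  imports Defs
begin

text \<open>
  The nonnegative gradient makes \<open>f x\<close> monotone on the orthant, so raising a component of \<open>z\<close> above that
  of \<open>z\<^sup>k\<close> only increases the objective: hence \<open>z\<^sup>k\<close> decreases to some \<open>w \<ge> 0\<close>, while \<open>x\<^sup>k\<close> stays in
  a sublevel set of the coercive component of \<open>F\<close>. Comparing with \<open>(x\<^sup>k, z\<^sup>k)\<close> shows that the
  values \<open>f x\<^sup>k z\<^sup>k\<close> decrease by at least \<open>l/2 q(x\<^sup>k\<^sup>+\<^sup>1, x\<^sup>k)\<^sup>2\<close>, so \<open>q(x\<^sup>k\<^sup>+\<^sup>1, x\<^sup>k) \<rightarrow> 0\<close>.
  If \<open>F y < F c\<close> at a cluster point \<open>c\<close>, then comparing with the point at parameter \<open>t\<close> of the segment from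
  \<open>x\<^sup>k\<^sup>+\<^sup>1\<close> to \<open>y\<close> and letting first \<open>k \<rightarrow> \<infinity>\<close> and then \<open>t \<rightarrow> 0\<close> gives \<open>f c w \<le> f y w\<close>,
  against (P3). Since \<open>F c \<le> F x\<^sup>k\<close>, (P3) allows replacing \<open>f x\<^sup>k\<close> by \<open>f c\<close>, so only continuity of
  \<open>f c\<close> and \<open>f y\<close> in \<open>z\<close> is needed at the possibly degenerate limit \<open>w\<close>.
\<close>

section \<open>Monotonicity on the orthant\<close>

lemma pos_orthant_subset_nonneg_orthant: "z \<in> pos_orthant \<Longrightarrow> z \<in> nonneg_orthant"
  by (auto simp: pos_orthant_def nonneg_orthant_def less_imp_le)

text \<open>The segment from \<open>u\<close> to \<open>v\<close> stays in the orthant, so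
  derivatives within the orthant suffice for the mean value theorem. The resulting slope
  \<open>h (p t) \<bullet> (v - u)\<close> pairs two vectors with nonnegative components.\<close>

lemma nonneg_gradient_imp_mono:
  fixes g :: "real ^ 'm \<Rightarrow> real"
  assumes deriv: "\<And>v. v \<in> nonneg_orthant \<Longrightarrow>
      (g has_derivative (\<lambda>d. h v \<bullet> d)) (at v within nonneg_orthant)"
    and nonneg: "\<And>v. v \<in> nonneg_orthant \<Longrightarrow> h v \<in> nonneg_orthant"
    and "u \<in> nonneg_orthant" and "u \<le> v"
  shows "g u \<le> g v"
proof -
  define p where "p t = u + t *\<^sub>R (v - u)" for t :: real
  have seg: "p t \<in> nonneg_orthant" if "t \<in> {0..1}" for t
    using that assms(3,4) by (auto simp: p_def nonneg_orthant_def less_eq_vec_def)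
  have "((\<lambda>t. g (p t)) has_derivative (\<lambda>d. h (p t) \<bullet> (d *\<^sub>R (v - u)))) (at t within {0..1})"
    if "t \<in> {0..1}" for t
  proof (rule has_derivative_in_compose2[where t = nonneg_orthant and g = g and f = p])
    show "(p has_derivative (\<lambda>d. d *\<^sub>R (v - u))) (at t within {0..1})"
      unfolding p_def by (auto intro!: derivative_eq_intros)
    show "(g has_derivative (\<lambda>d. h y \<bullet> d)) (at y within nonneg_orthant)"
      if "y \<in> nonneg_orthant" for y using deriv that .
  qed (use seg that in auto)
  then obtain t where t: "t \<in> {0<..<1}"
    and eq: "g (p 1) - g (p 0) = h (p t) \<bullet> ((1 - 0) *\<^sub>R (v - u))"
    using mvt_simple[of 0 1 "\<lambda>t. g (p t)" "\<lambda>t d. h (p t) \<bullet> (d *\<^sub>R (v - u))"] by auto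
  have "h (p t) \<in> nonneg_orthant"
    using nonneg seg t by simp
  then have "0 \<le> h (p t) \<bullet> (v - u)"
    using \<open>u \<le> v\<close> by (auto simp: inner_vec_def nonneg_orthant_def less_eq_vec_def intro!: sum_nonneg)
  then show ?thesis
    using eq by (simp add: p_def)
qed

section \<open>The logarithmic-quadratic term\<close>

lemma log_quad_term_eq:
  "log_quad_term z w = (\<Sum>i\<in>UNIV. z $ i / w $ i - ln (z $ i / w $ i) - 1)"
  by (simp add: log_quad_term_def inner_vec_def)

lemma log_quad_term_nonneg:
  assumes "z \<in> pos_orthant" "w \<in> pos_orthant"
  shows "0 \<le> log_quad_term z w"
  unfolding log_quad_term_eq
proof (rule sum_nonneg)
  fix i
  have "0 < z $ i / w $ i"
    using assms by (simp add: pos_orthant_def)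
  from ln_le_minus_one[OF this] show "0 \<le> z $ i / w $ i - ln (z $ i / w $ i) - 1"
    by simp
qed

lemma log_quad_term_self:
  assumes "w \<in> pos_orthant"
  shows "log_quad_term w w = 0"
proof -
  have "w $ i \<noteq> 0" for i
    using assms by (auto simp: pos_orthant_def dest: spec[of _ i])
  then show ?thesis
    by (simp add: log_quad_term_eq)
qed

text \<open>The function \<open>s - ln s - 1\<close> vanishes at \<open>s = 1\<close> and is
  positive at every other \<open>s > 0\<close>. Passing to \<open>inf z w\<close> resets exactly the
  ratios above 1 to 1 and keeps the rest.\<close>

lemma log_quad_term_inf_less:
  fixes z w :: "real ^ 'm"
  assumes "z \<in> pos_orthant" "w \<in> pos_orthant" "\<not> z \<le> w"
  shows "log_quad_term (inf z w) w < log_quad_term z w"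
proof -
  have pos: "0 < z $ i" "0 < w $ i" for i
    using assms by (auto simp: pos_orthant_def)
  obtain j where j: "w $ j < z $ j"
    using assms(3) by (auto simp: less_eq_vec_def not_le)
  have strict: "ln (z $ i / w $ i) < z $ i / w $ i - 1" if "w $ i < z $ i" for i
  proof -
    have "0 < z $ i / w $ i" "z $ i / w $ i \<noteq> 1"
      using pos[of i] that by auto
    then show ?thesis
      using ln_le_minus_one ln_eq_minus_one by fastforce
  qed
  show ?thesis
    unfolding log_quad_term_eq
  proof (rule sum_strict_mono_ex1)
    show "\<forall>i\<in>UNIV. inf z w $ i / w $ i - ln (inf z w $ i / w $ i) - 1
        \<le> z $ i / w $ i - ln (z $ i / w $ i) - 1"
    proof
      fix i
      show "inf z w $ i / w $ i - ln (inf z w $ i / w $ i) - 1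
          \<le> z $ i / w $ i - ln (z $ i / w $ i) - 1"
        using pos[of i] strict[of i] by (cases "w $ i < z $ i") (auto simp: inf_vec_def inf_real_def)
    qed
    show "\<exists>i\<in>UNIV. inf z w $ i / w $ i - ln (inf z w $ i / w $ i) - 1
        < z $ i / w $ i - ln (z $ i / w $ i) - 1"
      using pos[of j] strict[OF j] j by (intro bexI[of _ j]) (auto simp: inf_vec_def inf_real_def)
  qed simp
qed

section \<open>Continuity and sublevel sets of convex maps\<close>

lemma convex_map_continuous:
  fixes F :: "real ^ 'n \<Rightarrow> real ^ 'm"
  assumes "convex_map F"
  shows "continuous_on UNIV F"
proof -
  have "continuous_on UNIV (\<lambda>x. F x $ i)" for i
    using assms by (intro convex_on_continuous) (auto simp: convex_map_def)
  then have "continuous_on UNIV (\<lambda>x. \<chi> i. F x $ i)"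
    by (rule continuous_on_vec_lambda)
  then show ?thesis
    by simp
qed

text \<open>With \<open>c\<close> the value of \<open>F\<close> at the current iterate, this makes
  the feasible set of a subproblem convex, so segments between feasible points supply
  competitors.\<close>

lemma convex_map_sublevel:
  assumes "convex_map F" "F u \<le> c" "F v \<le> c" "0 \<le> t" "t \<le> 1"
  shows "F ((1 - t) *\<^sub>R u + t *\<^sub>R v) \<le> c"
  unfolding less_eq_vec_def
proof
  fix i
  have "F ((1 - t) *\<^sub>R u + t *\<^sub>R v) $ i \<le> (1 - t) * F u $ i + t * F v $ i"
    using assms by (intro convex_onD) (auto simp: convex_map_def)
  also have "\<dots> \<le> (1 - t) * c $ i + t * c $ i"
    using assms by (intro add_mono mult_left_mono) (auto simp: less_eq_vec_def)
  finally show "F ((1 - t) *\<^sub>R u + t *\<^sub>R v) $ i \<le> c $ i"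
    by (simp add: algebra_simps)
qed

section \<open>Limits and boundedness\<close>

lemma le_zero_if_le_small_multiples:
  fixes d C :: real
  assumes "\<And>t. 0 < t \<Longrightarrow> t \<le> 1 \<Longrightarrow> d \<le> C * t"
  shows "d \<le> 0"
proof (rule LIMSEQ_le_const)
  show "(\<lambda>n. C * inverse (real (Suc n))) \<longlonglongrightarrow> 0"
    using tendsto_mult[OF tendsto_const LIMSEQ_inverse_real_of_nat, of C] by simp
  have "d \<le> C * inverse (real (Suc n))" for n
    by (rule assms) (auto simp: field_simps)
  then show "\<exists>N. \<forall>n\<ge>N. d \<le> C * inverse (real (Suc n))"
    by blast
qed

text \<open>The values \<open>v k\<close> decrease and are bounded below, hence converge; their
  successive differences tend to 0 and dominate the squares.\<close>

lemma tendsto_zero_if_square_le_decrease: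
  fixes p v :: "nat \<Rightarrow> real"
  assumes "0 < c" and decr: "\<And>k. c * (p k)\<^sup>2 \<le> v k - v (Suc k)" and bdd: "\<And>k. \<alpha> \<le> v k"
  shows "p \<longlonglongrightarrow> 0"
proof -
  have "v (Suc k) \<le> v k" for k
    using decr[of k] mult_nonneg_nonneg[of c "(p k)\<^sup>2"] \<open>0 < c\<close>
    by (metis diff_ge_0_iff_ge less_imp_le order_trans zero_le_power2)
  then have "decseq v"
    by (rule decseq_SucI)
  then obtain w where w: "v \<longlonglongrightarrow> w"
    using decseq_convergent bdd by blast
  have "(\<lambda>k. (v k - v (Suc k)) / c) \<longlonglongrightarrow> (w - w) / c"
    using \<open>0 < c\<close> by (intro tendsto_intros w LIMSEQ_Suc) auto
  then have lim: "(\<lambda>k. (v k - v (Suc k)) / c) \<longlonglongrightarrow> 0"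
    by simp
  have "(\<lambda>k. (p k)\<^sup>2) \<longlonglongrightarrow> 0"
  proof (rule tendsto_sandwich[OF _ _ tendsto_const lim])
    show "\<forall>\<^sub>F k in sequentially. (p k)\<^sup>2 \<le> (v k - v (Suc k)) / c"
      using decr \<open>0 < c\<close> by (intro always_eventually) (auto simp: field_simps)
  qed simp
  then show ?thesis
    by simp
qed

lemma decseq_orthant_convergent:
  fixes z :: "nat \<Rightarrow> real ^ 'm"
  assumes "\<And>k. z k \<in> nonneg_orthant" and "\<And>k. z (Suc k) \<le> z k"
  obtains w where "z \<longlonglongrightarrow> w" and "w \<in> nonneg_orthant"
proof -
  have "\<exists>w. (\<lambda>k. z k $ i) \<longlonglongrightarrow> w" for i
  proof -
    have "decseq (\<lambda>k. z k $ i)"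
      using assms(2) by (intro decseq_SucI) (simp add: less_eq_vec_def)
    moreover have "0 \<le> z k $ i" for k
      using assms(1)[of k] by (simp add: nonneg_orthant_def)
    ultimately show ?thesis
      using decseq_convergent by blast
  qed
  then obtain w where w: "\<And>i. (\<lambda>k. z k $ i) \<longlonglongrightarrow> w i"
    by metis
  show thesis
  proof
    show "z \<longlonglongrightarrow> (\<chi> i. w i)"
      by (rule vec_tendstoI) (simp add: w)
    have "0 \<le> w i" for i
      using assms(1) by (intro LIMSEQ_le_const[OF w]) (auto simp: nonneg_orthant_def)
    then show "(\<chi> i. w i) \<in> nonneg_orthant"
      by (simp add: nonneg_orthant_def)
  qed
qed

lemma coercive_sublevel_bounded:
  fixes g :: "'a::real_normed_vector \<Rightarrow> real"
  assumes "filterlim g at_top at_infinity"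
  shows "bounded {u. g u \<le> c}"
proof -
  have "\<forall>\<^sub>F u in at_infinity. c < g u"
    using assms filterlim_at_top_dense by blast
  then obtain B where B: "\<And>u. B \<le> norm u \<Longrightarrow> c < g u"
    by (auto simp: eventually_at_infinity)
  have "norm u \<le> B" if "g u \<le> c" for u
    using B[of u] that by linarith
  then show ?thesis
    by (auto simp: bounded_iff)
qed

theorem theorem4p1:
  fixes F :: "real ^ 'n \<Rightarrow> real ^ 'm"
    and f :: "real ^ 'n \<Rightarrow> real ^ 'm \<Rightarrow> real"
    and q :: "real ^ 'n \<Rightarrow> real ^ 'n \<Rightarrow> real"
    and a b l L :: real
    and \<mu> \<beta> :: "nat \<Rightarrow> real"
    and x :: "nat \<Rightarrow> real ^ 'n"
    and z :: "nat \<Rightarrow> real ^ 'm"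
  assumes "convex_map F"
    and "\<exists>r. filterlim (\<lambda>u. F u $ r) at_top at_infinity"
    and "prop_P1 f" and "prop_P2 f" and "prop_P3 F f" and "prop_P4 f"
    and "quasi_distance q"
    and "0 < a" and "0 < b"
    and "\<And>u v. a * norm (u - v) \<le> q u v \<and> q u v \<le> b * norm (u - v)"
    and "0 < l" and "\<And>k. l < \<mu> k \<and> \<mu> k < L"
    and "\<And>k. 0 < \<beta> k"
    and "lqdps_sequence F f q \<beta> \<mu> x z"
  shows "bounded (range (\<lambda>k. (x k, z k))) \<and>
         (\<forall>c. seq_cluster_point x c \<longrightarrow> weak_pareto F c)"
proof -
  obtain h where h: "\<And>u v. v \<in> nonneg_orthant \<Longrightarrow> h u v \<in> nonneg_orthant"
    and dh: "\<And>u v. v \<in> nonneg_orthant \<Longrightarrow>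
      (f u has_derivative (\<lambda>d. h u v \<bullet> d)) (at v within nonneg_orthant)"
    using assms(6) unfolding prop_P4_def by blast
  have mono: "f u v \<le> f u w" if "v \<in> nonneg_orthant" "v \<le> w" for u v w
    using nonneg_gradient_imp_mono[of "f u" "h u"] h dh that by blast
  obtain \<alpha> where \<alpha>: "\<And>u v. v \<in> nonneg_orthant \<Longrightarrow> \<alpha> \<le> f u v"
    using assms(3) unfolding prop_P1_def by blast
  have P3: "F u \<le> F y \<Longrightarrow> f u v \<le> f y v" "(\<forall>i. F u $ i < F y $ i) \<Longrightarrow> f u v < f y v"
    if "v \<in> nonneg_orthant" for u y v
    using assms(5) that unfolding prop_P3_def by blast+
  have conv: "f ((1 - t) *\<^sub>R u + t *\<^sub>R y) v \<le> (1 - t) * f u v + t * f y v"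
    if "v \<in> nonneg_orthant" "0 \<le> t" "t \<le> 1" for u y v t
  proof -
    \<comment> \<open>Two points sharing the second component \<open>v\<close> reduce joint
      convexity to convexity in the first argument.\<close>
    have "(1 - t) *\<^sub>R (u, v) + t *\<^sub>R (y, v) = ((1 - t) *\<^sub>R u + t *\<^sub>R y, v)"
      by (simp add: scaleR_left_distrib[symmetric])
    then show ?thesis
      using convex_onD[of "UNIV \<times> nonneg_orthant" "\<lambda>(x, z). f x z" t "(u, v)" "(y, v)"]
        assms(4) that by (simp add: prop_P2_def)
  qed
  have step: "F (x (Suc k)) \<le> F (x k)" "z (Suc k) \<in> pos_orthant"
    and z0: "z 0 \<in> pos_orthant"
    and opt: "\<And>u v. F u \<le> F (x k) \<Longrightarrow> v \<in> pos_orthant \<Longrightarrow>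
      f (x (Suc k)) (z (Suc k)) + \<beta> k * log_quad_term (z (Suc k)) (z k)
        + \<mu> k / 2 * (q (x (Suc k)) (x k))\<^sup>2
      \<le> f u v + \<beta> k * log_quad_term v (z k) + \<mu> k / 2 * (q u (x k))\<^sup>2" for k
    using assms(14) unfolding lqdps_sequence_def is_arg_min_def lqdps_objective_def
    by (fastforce simp: not_less)+
  have zpos: "z k \<in> pos_orthant" for k
    using z0 step(2) by (cases k) auto
  note znn = pos_orthant_subset_nonneg_orthant[OF zpos]
  have \<beta>: "0 < \<beta> k" and \<mu>: "l < \<mu> k" "\<mu> k < L" "0 < \<mu> k" for k
    using assms(11,12,13) less_trans by blast+
  have qnn: "0 \<le> q u v" and qtri: "q u v \<le> q u w + q w v" and qb: "q u v \<le> b * norm (u - v)"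
    and qself: "q u u = 0" for u v w
    using assms(7,10) unfolding quasi_distance_def by blast+

  \<comment> \<open>Monotone convergence of the second component\<close>
  have zdec: "z (Suc k) \<le> z k" for k
  proof (rule ccontr)
    \<comment> \<open>The competitor keeps \<open>x (Suc k)\<close> and caps
      \<open>z (Suc k)\<close> at \<open>z k\<close>: the logarithmic term drops strictly,
      \<open>f\<close> does not rise by \<open>mono\<close>, and the quasi-distance term is
      unchanged.\<close>
    assume "\<not> z (Suc k) \<le> z k"
    then have "\<beta> k * log_quad_term (inf (z (Suc k)) (z k)) (z k)
        < \<beta> k * log_quad_term (z (Suc k)) (z k)"
      by (intro mult_strict_left_mono log_quad_term_inf_less zpos \<beta>)
    moreover have inf_pos: "inf (z (Suc k)) (z k) \<in> pos_orthant"
      using zpos[of k] zpos[of "Suc k"] by (simp add: pos_orthant_def inf_vec_def inf_real_def)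
    moreover have "f (x (Suc k)) (inf (z (Suc k)) (z k)) \<le> f (x (Suc k)) (z (Suc k))"
      using inf_pos by (intro mono pos_orthant_subset_nonneg_orthant) auto
    ultimately show False
      using opt[OF step(1) inf_pos, of k] by linarith
  qed
  obtain w where zw: "z \<longlonglongrightarrow> w" and w: "w \<in> nonneg_orthant"
    using decseq_orthant_convergent[of z] znn zdec by blast
  have Fdec: "F (x j) \<le> F (x k)" if "k \<le> j" for j k
    using that step(1) by (rule lift_Suc_antimono_le[rotated])

  \<comment> \<open>Boundedness of the iterates\<close>
  have "bounded (range x)"
  proof -
    obtain r where r: "filterlim (\<lambda>u. F u $ r) at_top at_infinity"
      using assms(2) by blast
    have "range x \<subseteq> {u. F u $ r \<le> F (x 0) $ r}"
      using Fdec[of 0] by (auto simp: less_eq_vec_def)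
    then show ?thesis
      using bounded_subset coercive_sublevel_bounded[OF r] by blast
  qed
  moreover have "bounded (range z)"
    using zw convergent_imp_bounded by blast
  ultimately have "bounded (range x \<times> range z)"
    by (rule bounded_Times)
  then have bdd: "bounded (range (\<lambda>k. (x k, z k)))"
    by (rule bounded_subset) auto

  \<comment> \<open>Vanishing step lengths\<close>
  define p where "p k = q (x (Suc k)) (x k)" for k
  have p0: "p \<longlonglongrightarrow> 0"
  proof (rule tendsto_zero_if_square_le_decrease)
    show "0 < l / 2"
      using assms(11) by simp
    show "\<alpha> \<le> f (x k) (z k)" for k
      using \<alpha> znn by blast
    show "l / 2 * (p k)\<^sup>2 \<le> f (x k) (z k) - f (x (Suc k)) (z (Suc k))" for k
    proof -
      have "l / 2 * (p k)\<^sup>2 \<le> \<mu> k / 2 * (p k)\<^sup>2"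
        using \<mu>(1)[of k] by (intro mult_right_mono) auto
      moreover have "0 \<le> \<beta> k * log_quad_term (z (Suc k)) (z k)"
        by (intro mult_nonneg_nonneg log_quad_term_nonneg zpos less_imp_le[OF \<beta>])
      \<comment> \<open>At the competitor \<open>(x k, z k)\<close> both regularizing terms are
        0.\<close>
      ultimately show ?thesis
        using opt[of "x k" k "z k"] zpos by (simp add: qself log_quad_term_self p_def)
    qed
  qed

  \<comment> \<open>Weak Pareto optimality of cluster points\<close>
  have "weak_pareto F c" if cluster: "seq_cluster_point x c" for c
    unfolding weak_pareto_def
  proof
    assume "\<exists>y. \<forall>i. F y $ i < F c $ i"
    then obtain y where y: "\<forall>i. F y $ i < F c $ i"
      by blast
    obtain s where s: "strict_mono s" and xs: "(x \<circ> s) \<longlonglongrightarrow> c"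
      using cluster unfolding seq_cluster_point_def by blast
    \<comment> \<open>The whole sequence of values of \<open>F\<close> decreases, so its limit along
      the subsequence lies below every term; \<open>s j\<close> is at least \<open>j\<close>, hence
      eventually past any given \<open>k\<close>.\<close>
    have Fc: "F c \<le> F (x k)" for k
      unfolding less_eq_vec_def
    proof
      fix i
      have "(\<lambda>j. F (x (s j))) \<longlonglongrightarrow> F c"
        using continuous_on_tendsto_compose[OF convex_map_continuous[OF assms(1)] xs] by simp
      then have "(\<lambda>j. F (x (s j)) $ i) \<longlonglongrightarrow> F c $ i"
        by (rule tendsto_vec_nth)
      moreover have "F (x (s j)) $ i \<le> F (x k) $ i" if "k \<le> j" for j
        using Fdec[of k "s j"] strict_mono_imp_increasing[OF s, of j] that
        by (auto simp: less_eq_vec_def)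
      ultimately show "F c $ i \<le> F (x k) $ i"
        by (intro LIMSEQ_le_const2) auto
    qed
    have Fy: "F y \<le> F (x k)" for k
      using y Fc[of k] unfolding less_eq_vec_def by (meson less_imp_le order_trans)
    obtain D where D: "\<And>k. norm (y - x k) \<le> D"
    proof -
      obtain B where "\<And>k. norm (x k) \<le> B"
        using \<open>bounded (range x)\<close> by (auto simp: bounded_iff)
      then have "norm (y - x k) \<le> norm y + B" for k
        using norm_triangle_ineq4[of y "x k"] add_left_mono order_trans by blast
      then show thesis
        using that by blast
    qed
    have D0: "0 \<le> D"
      using D[of 0] norm_ge_zero order_trans by blast
    have key: "f c (z (Suc k)) - f y (z (Suc k)) \<le> L / 2 * (b\<^sup>2 * D\<^sup>2 * t + 2 * b * D * p k)"
      if t: "0 < t" "t \<le> 1" for k t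
    proof -
      \<comment> \<open>The competitor \<open>(?u, z (Suc k))\<close> keeps the second component, so
        the logarithmic terms cancel. The triangle inequality through \<open>x (Suc k)\<close>
        splits its distance to \<open>x k\<close> into a part of order \<open>t\<close> and
        \<open>p k\<close>.\<close>
      let ?u = "(1 - t) *\<^sub>R x (Suc k) + t *\<^sub>R y"
      have "q ?u (x k) \<le> q ?u (x (Suc k)) + p k"
        unfolding p_def by (rule qtri)
      also have "q ?u (x (Suc k)) \<le> b * norm (?u - x (Suc k))"
        by (rule qb)
      also have "?u - x (Suc k) = t *\<^sub>R (y - x (Suc k))"
        by (simp add: algebra_simps)
      also have "b * norm (t *\<^sub>R (y - x (Suc k))) \<le> b * (t * D)"
        using D[of "Suc k"] t \<open>0 < b\<close> by simp
      finally have "(q ?u (x k))\<^sup>2 \<le> (b * (t * D) + p k)\<^sup>2"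
        using qnn by (intro power_mono) auto
      then have "\<mu> k / 2 * (q ?u (x k))\<^sup>2 \<le> \<mu> k / 2 * (b * (t * D) + p k)\<^sup>2"
        using \<mu>(3)[of k] by (intro mult_left_mono) auto
      moreover have "F ?u \<le> F (x k)"
        using t convex_map_sublevel[OF assms(1) step(1) Fy] by simp
      ultimately have "f (x (Suc k)) (z (Suc k)) + \<mu> k / 2 * (p k)\<^sup>2
          \<le> f ?u (z (Suc k)) + \<mu> k / 2 * (b * (t * D) + p k)\<^sup>2"
        using opt[of ?u k "z (Suc k)"] zpos[of "Suc k"] by (simp add: p_def)
      also have "f ?u (z (Suc k)) \<le> (1 - t) * f (x (Suc k)) (z (Suc k)) + t * f y (z (Suc k))"
        using t by (intro conv znn) auto
      \<comment> \<open>Expanding the square cancels \<open>(p k)\<^sup>2\<close>; everything left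
        carries a factor \<open>t\<close>, which is then divided out.\<close>
      finally have "t * (f (x (Suc k)) (z (Suc k)) - f y (z (Suc k)))
          \<le> t * (\<mu> k / 2 * (b\<^sup>2 * D\<^sup>2 * t + 2 * b * D * p k))"
        by (simp add: algebra_simps power2_eq_square)
      then have "f (x (Suc k)) (z (Suc k)) - f y (z (Suc k))
          \<le> \<mu> k / 2 * (b\<^sup>2 * D\<^sup>2 * t + 2 * b * D * p k)"
        using t by simp
      also have "\<dots> \<le> L / 2 * (b\<^sup>2 * D\<^sup>2 * t + 2 * b * D * p k)"
        using \<mu>(2)[of k] t D0 \<open>0 < b\<close> qnn by (intro mult_right_mono) (auto simp: p_def)
      finally show ?thesis
        using P3(1)[OF znn Fc, of "Suc k" "Suc k"] by linarith
    qed
    \<comment> \<open>Differentiability within the orthant gives continuity there even if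
      \<open>w\<close> lies on the boundary.\<close>
    have flim: "(\<lambda>k. f u (z (Suc k))) \<longlonglongrightarrow> f u w" for u
      using has_derivative_continuous[OF dh[OF w]] znn LIMSEQ_Suc[OF zw]
      by (rule continuous_within_tendsto_compose'[where S = nonneg_orthant])
    \<comment> \<open>With \<open>t\<close> fixed, \<open>k\<close> tends to infinity and the term
      in \<open>p k\<close> disappears, leaving a bound linear in \<open>t\<close>.\<close>
    have "f c w - f y w \<le> (L / 2 * (b\<^sup>2 * D\<^sup>2)) * t" if t: "0 < t" "t \<le> 1" for t
    proof (rule LIMSEQ_le)
      show "(\<lambda>k. f c (z (Suc k)) - f y (z (Suc k))) \<longlonglongrightarrow> f c w - f y w"
        by (intro tendsto_diff flim)
      have "(\<lambda>k. L / 2 * (b\<^sup>2 * D\<^sup>2 * t + 2 * b * D * p k))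
          \<longlonglongrightarrow> L / 2 * (b\<^sup>2 * D\<^sup>2 * t + 2 * b * D * 0)"
        by (intro tendsto_intros p0)
      then show "(\<lambda>k. L / 2 * (b\<^sup>2 * D\<^sup>2 * t + 2 * b * D * p k))
          \<longlonglongrightarrow> (L / 2 * (b\<^sup>2 * D\<^sup>2)) * t"
        by (simp add: mult.assoc)
    qed (use key[OF t] in blast)
    then have "f c w - f y w \<le> 0"
      by (rule le_zero_if_le_small_multiples)
    then show False
      using P3(2)[OF w y] by simp
  qed
  with bdd show ?thesis
    by blast
qed

end
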